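(* Let $k$ be a field of characteristic zero. There exist codimension 3 level algebras $A=k[x_1,x_2,x_3]/I$ of type 3 not enjoying the Weak Lefschetz Property.
   Context: A standard graded artinian algebra is $A=R/I$, where $R=k[x_1,\dots,x_r]$ with all $x_i$ of degree 1 and $I$ is a homogeneous ideal of $R$ containing no non-zero forms of degree at most 1, such that $\dim_k A<\infty$. The $h$-vector of $A$ is $(h_0,h_1,\dots,h_e)$, where $h_i=\dim_k A_i$ and $e$ is the last index with $\dim_k A_e>0$; $e$ is the socle degree of $A$. The codimension of $A$ is $r=h_1$. The socle of $A$ is $\mathrm{soc}(A)=\{a\in A : a\,\overline{m}=0\}$, where $\overline{m}=(\overline{x_1},\dots,\overline{x_r})\subseteq A$; it is a homogeneous ideal. $A$ is level of type $t$ if $\mathrm{soc}(A)_i=0$ for all $i<e$ and $\dim_k \mathrm{soc}(A)_e=\dim_k A_e=t$. $A=\bigoplus_{i=0}^e A_i$ enjoys the Weak Lefschetz Property if there exists a linear form $L\in R_1$ such that, for all $i=0,1,\dots,e-1$, the multiplication map $\cdot L: A_i\to A_{i+1}$ has maximal rank as a $k$-linear map (i.e. is injective or surjective). *)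

theory Defs
  imports
    "HOL-Algebra.Algebra"
    "HOL-Algebra.Algebraic_Closure_Type"
    "HOL-Library.Poly_Mapping"
    "HOL-Library.Numeral_Type"
begin

text \<open>
  The polynomial ring over the field \<open>'k\<close> whose variables are indexed by the finite type \<open>'v\<close>
  (so in \<open>CARD('v)\<close> variables): a monomial is an exponent vector \<open>'v \<Rightarrow>\<^sub>0 nat\<close>, a polynomial a
  finitely supported map from monomials to coefficients, and multiplication is the convolution
  product of the library.
\<close>

type_synonym ('v, 'k) mpoly = "('v \<Rightarrow>\<^sub>0 nat) \<Rightarrow>\<^sub>0 'k"

abbreviation mpoly_ring :: "('v, 'k::field) mpoly ring" where
  "mpoly_ring \<equiv> ring_of_type_algebra"

definition monomial_degree :: "('v::finite \<Rightarrow>\<^sub>0 nat) \<Rightarrow> nat" where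
  "monomial_degree m = (\<Sum>x\<in>UNIV. Poly_Mapping.lookup m x)"

definition const :: "'k \<Rightarrow> ('v, 'k::field) mpoly" where
  "const c = Poly_Mapping.single 0 c"

definition var :: "'v \<Rightarrow> ('v, 'k::field) mpoly" where
  "var x = Poly_Mapping.single (Poly_Mapping.single x 1) 1"

text \<open>The zero polynomial is a form of every degree, so that \<open>forms d\<close> is the graded piece \<open>R\<^sub>d\<close>.\<close>

definition forms :: "nat \<Rightarrow> ('v::finite, 'k::field) mpoly set" where
  "forms d = {p. \<forall>m\<in>Poly_Mapping.keys p. monomial_degree m = d}"

definition homogeneous_ideal :: "('v::finite, 'k::field) mpoly set \<Rightarrow> bool" where
  "homogeneous_ideal I \<longleftrightarrow>
     ideal I mpoly_ring \<and> (\<exists>S. S \<subseteq> (\<Union>d. forms d) \<and> I = Idl\<^bsub>mpoly_ring\<^esub> S)"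

text \<open>
  All notions below concern the quotient \<open>A = R/I\<close> and are parametrised by \<open>I\<close>. The base field is
  identified with its image in \<open>A\<close>, which is a subfield of \<open>A\<close> whenever \<open>I\<close> is proper; dimensions
  are dimensions over that subfield.
\<close>

abbreviation quotient_alg :: "('v, 'k::field) mpoly set \<Rightarrow> ('v, 'k) mpoly set ring" where
  "quotient_alg I \<equiv> mpoly_ring Quot I"

definition residue_class ::
    "('v, 'k::field) mpoly set \<Rightarrow> ('v, 'k) mpoly \<Rightarrow> ('v, 'k) mpoly set" where
  "residue_class I p = I +>\<^bsub>mpoly_ring\<^esub> p"

definition base_field :: "('v, 'k::field) mpoly set \<Rightarrow> ('v, 'k) mpoly set set" where
  "base_field I = residue_class I ` range const"

definition graded_piece ::
    "('v::finite, 'k::field) mpoly set \<Rightarrow> nat \<Rightarrow> ('v, 'k) mpoly set set" where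
  "graded_piece I i = residue_class I ` forms i"

definition dim_k :: "('v, 'k::field) mpoly set \<Rightarrow> ('v, 'k) mpoly set set \<Rightarrow> nat" where
  "dim_k I E = ring.dim (quotient_alg I) (base_field I) E"

definition standard_graded_artinian :: "('v::finite, 'k::field) mpoly set \<Rightarrow> bool" where
  "standard_graded_artinian I \<longleftrightarrow>
     homogeneous_ideal I \<and>
     (\<forall>d\<le>1. \<forall>p\<in>I \<inter> forms d. p = 0) \<and>
     ring.finite_dimension (quotient_alg I) (base_field I) (carrier (quotient_alg I))"

definition h_vector :: "('v::finite, 'k::field) mpoly set \<Rightarrow> nat \<Rightarrow> nat" where
  "h_vector I i = dim_k I (graded_piece I i)"

definition socle_degree :: "('v::finite, 'k::field) mpoly set \<Rightarrow> nat" where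
  "socle_degree I = (GREATEST i. h_vector I i > 0)"

definition codimension :: "('v::finite, 'k::field) mpoly set \<Rightarrow> nat" where
  "codimension I = h_vector I 1"

definition irrelevant_ideal :: "('v, 'k::field) mpoly set \<Rightarrow> ('v, 'k) mpoly set set" where
  "irrelevant_ideal I = Idl\<^bsub>quotient_alg I\<^esub> (residue_class I ` range var)"

definition socle :: "('v, 'k::field) mpoly set \<Rightarrow> ('v, 'k) mpoly set set" where
  "socle I = {a \<in> carrier (quotient_alg I).
     \<forall>b\<in>irrelevant_ideal I. a \<otimes>\<^bsub>quotient_alg I\<^esub> b = \<zero>\<^bsub>quotient_alg I\<^esub>}"

definition socle_piece :: "('v::finite, 'k::field) mpoly set \<Rightarrow> nat \<Rightarrow> ('v, 'k) mpoly set set" where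
  "socle_piece I i = socle I \<inter> graded_piece I i"

definition level_of_type :: "('v::finite, 'k::field) mpoly set \<Rightarrow> nat \<Rightarrow> bool" where
  "level_of_type I t \<longleftrightarrow>
     (\<forall>i<socle_degree I. socle_piece I i = {\<zero>\<^bsub>quotient_alg I\<^esub>}) \<and>
     dim_k I (socle_piece I (socle_degree I)) = t \<and>
     dim_k I (graded_piece I (socle_degree I)) = t"

definition weak_lefschetz :: "('v::finite, 'k::field) mpoly set \<Rightarrow> bool" where
  "weak_lefschetz I \<longleftrightarrow>
     (\<exists>L\<in>forms 1. \<forall>i<socle_degree I.
        let mult_L = (\<lambda>a. residue_class I L \<otimes>\<^bsub>quotient_alg I\<^esub> a) in
          inj_on mult_L (graded_piece I i) \<or>
          mult_L ` graded_piece I i = graded_piece I (Suc i))"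

end

theory Submission
  imports Defs
begin

text \<open>
  In $A = k[x,y,z]/(x^3,y^3,z^3,xyz)$, with $h$-vector $(1,3,6,6,3)$, every standard monomial of
  degree below 4 has a standard multiple one degree higher, so the socle is $A_4$, spanned by
  $x^2y^2$, $x^2z^2$, $y^2z^2$. For each linear form $L$, multiplication $A_2 \to A_3$ is not
  injective, because $a^3x^3+b^3y^3+c^3z^3-3abc\,xyz$ is divisible by $L = ax+by+cz$, and it is not
  surjective, because its image lies in the kernel of an explicit functional on $A_3$ (when two
  of $a$, $b$, $c$ vanish, it misses a monomial instead).
\<close>

section \<open>Monomials and coefficients\<close>

text \<open>Exponents cancel: \<open>m + s = l + s\<close> forces \<open>l = m\<close>, so a single
  term of the convolution sum survives.\<close>

lemma lookup_times_single_add: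
  fixes p :: "('v, 'k::field) mpoly"
  shows "Poly_Mapping.lookup (p * Poly_Mapping.single s c) (m + s) = Poly_Mapping.lookup p m * c"
proof -
  have "(\<Sum>q. Poly_Mapping.lookup (Poly_Mapping.single s c) q when m + s = l + q) = (c when l = m)" for l
  proof -
    have "(\<lambda>q. Poly_Mapping.lookup (Poly_Mapping.single s c) q when m + s = l + q)
        = (\<lambda>q. (c when l = m) when s = q)"
      by (auto simp: lookup_single when_def fun_eq_iff)
    then show ?thesis by (simp only: Sum_any_when_equal')
  qed
  then show ?thesis by (simp add: lookup_mult mult_when)
qed

lemma lookup_times_single_eq_0:
  fixes p :: "('v, 'k::field) mpoly"
  assumes "\<And>l. m \<noteq> l + s"
  shows "Poly_Mapping.lookup (p * Poly_Mapping.single s c) m = 0"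
proof -
  have "m \<notin> Poly_Mapping.keys (p * Poly_Mapping.single s c)"
    using keys_mult[of p "Poly_Mapping.single s c"] assms by (auto split: if_splits)
  then show ?thesis by (simp add: in_keys_iff)
qed

lemma lookup_const_times [simp]:
  "Poly_Mapping.lookup (const c * p) m = c * Poly_Mapping.lookup p m"
  using lookup_times_single_add[of p 0 c m] by (simp add: const_def mult.commute)

lemma monomial_degree_add [simp]:
  "monomial_degree (m + n) = monomial_degree m + monomial_degree n"
  by (simp add: monomial_degree_def lookup_add sum.distrib)

lemma monomial_degree_zero [simp]: "monomial_degree 0 = 0"
  by (simp add: monomial_degree_def)

lemma monomial_degree_single [simp]: "monomial_degree (Poly_Mapping.single x n) = n"
  by (simp add: monomial_degree_def lookup_single when_def)

lemma poly_mapping_eq_sum_single: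
  "p = (\<Sum>m\<in>Poly_Mapping.keys p. Poly_Mapping.single m (Poly_Mapping.lookup p m))"
  by (rule poly_mapping_eqI) (auto simp: lookup_sum lookup_single when_def in_keys_iff)

lemma const_add: "const (a + b) = const a + const b"
  by (simp add: const_def single_add)

lemma const_mult: "const (a * b) = const a * const b"
  by (simp add: const_def mult_single)

lemma const_one: "const 1 = 1"
  by (simp add: const_def)

lemma forms_lookup: "p \<in> forms d \<longleftrightarrow> (\<forall>m. monomial_degree m \<noteq> d \<longrightarrow> Poly_Mapping.lookup p m = 0)"
  by (auto simp: forms_def in_keys_iff)

section \<open>Polynomials as a commutative ring\<close>

lemma ring_of_type_algebra_simps [simp]:
  "carrier ring_of_type_algebra = UNIV"
  "p \<otimes>\<^bsub>ring_of_type_algebra\<^esub> q = p * q"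
  "p \<oplus>\<^bsub>ring_of_type_algebra\<^esub> q = p + q"
  "\<one>\<^bsub>ring_of_type_algebra\<^esub> = 1"
  "\<zero>\<^bsub>ring_of_type_algebra\<^esub> = 0"
  by (simp_all add: ring_of_type_algebra_def)

lemma cring_mpoly_ring: "cring (mpoly_ring :: ('v, 'k::field) mpoly ring)"
  by rule

lemma mpoly_ring_a_inv [simp]: "\<ominus>\<^bsub>mpoly_ring\<^esub> p = - (p :: ('v, 'k::field) mpoly)"
proof -
  interpret cring "mpoly_ring :: ('v, 'k) mpoly ring" by (rule cring_mpoly_ring)
  show ?thesis using minus_equality[of "- p" p] by simp
qed

section \<open>Quotients by monomial ideals\<close>

text \<open>The ideal is described by the set \<open>B\<close> of all monomials it contains rather
  than by generators. The monomials outside \<open>B\<close>, the standard ones, then serve as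
  coordinates on the quotient. \<open>add_closed\<close> expresses absorption of monomial factors,
  and \<open>zero_notin\<close> keeps the ideal proper.\<close>

locale monomial_ideal =
  fixes B :: "('v::finite \<Rightarrow>\<^sub>0 nat) set" and I :: "('v, 'k::field) mpoly set"
  assumes mem_iff: "p \<in> I \<longleftrightarrow> Poly_Mapping.keys p \<subseteq> B"
    and add_closed: "m \<in> B \<Longrightarrow> n + m \<in> B"
    and zero_notin: "0 \<notin> B"
begin

abbreviation A where "A \<equiv> quotient_alg I"

lemma mem_iff_lookup: "p \<in> I \<longleftrightarrow> (\<forall>m. m \<notin> B \<longrightarrow> Poly_Mapping.lookup p m = 0)"
  by (auto simp: mem_iff in_keys_iff)

lemma mult_mem: "p \<in> I \<Longrightarrow> q * p \<in> I"
  unfolding mem_iff using keys_mult[of q p] add_closed by blast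

sublocale ideal I mpoly_ring
proof -
  interpret R: cring "mpoly_ring :: ('v, 'k) mpoly ring" by (rule cring_mpoly_ring)
  have "I \<noteq> {}" using mem_iff[of 0] by auto
  then have sub: "subgroup I (add_monoid mpoly_ring)"
    by (intro R.add.subgroupI) (auto simp: mem_iff_lookup lookup_add simp flip: a_inv_def)
  show "ideal I mpoly_ring"
  proof (rule idealI[OF R.ring_axioms sub])
    fix p q :: "('v, 'k) mpoly"
    assume "p \<in> I"
    then have "q * p \<in> I" by (rule mult_mem)
    then show "q \<otimes>\<^bsub>mpoly_ring\<^esub> p \<in> I" "p \<otimes>\<^bsub>mpoly_ring\<^esub> q \<in> I"
      by (simp_all only: ring_of_type_algebra_simps mult.commute[of p q])
  qed
qed

sublocale A: cring A
  by (rule quotient_is_cring[OF cring_mpoly_ring])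

text \<open>Two polynomials are congruent iff their difference is supported on \<open>B\<close>.
  Equality in \<open>A\<close> thereby becomes a comparison of coefficients at standard
  monomials.\<close>

lemma residue_class_eq_iff:
  "residue_class I p = residue_class I q \<longleftrightarrow>
     (\<forall>m. m \<notin> B \<longrightarrow> Poly_Mapping.lookup p m = Poly_Mapping.lookup q m)"
proof -
  have "residue_class I p = residue_class I q \<longleftrightarrow> q \<in> I +>\<^bsub>mpoly_ring\<^esub> p"
    unfolding residue_class_def using a_repr_independence' a_repr_independenceD
    by (metis UNIV_I ring_of_type_algebra_simps(1))
  also have "\<dots> \<longleftrightarrow> q - p \<in> I"
    using a_rcos_module[of p q] by simp
  finally show ?thesis by (auto simp: mem_iff_lookup lookup_minus)
qed

lemma carrier_A: "carrier A = range (residue_class I)"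
  by (auto simp: FactRing_def A_RCOSETS_def' residue_class_def)

lemma residue_class_carrier [simp]: "residue_class I p \<in> carrier A"
  by (simp add: carrier_A)

lemma residue_class_simps:
  "residue_class I p \<otimes>\<^bsub>A\<^esub> residue_class I q = residue_class I (p * q)"
  "residue_class I p \<oplus>\<^bsub>A\<^esub> residue_class I q = residue_class I (p + q)"
  "\<one>\<^bsub>A\<^esub> = residue_class I 1"
  using ring_hom_mult[OF rcos_ring_hom, of p q] ring_hom_add[OF rcos_ring_hom, of p q]
    ring_hom_one[OF rcos_ring_hom]
  by (simp_all add: residue_class_def)

lemma zero_A: "\<zero>\<^bsub>A\<^esub> = residue_class I 0"
  using ring_hom_zero[OF rcos_ring_hom] local.ring_axioms A.ring_axioms
  by (simp add: residue_class_def)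

lemma residue_class_eq_zero_iff: "residue_class I p = \<zero>\<^bsub>A\<^esub> \<longleftrightarrow> p \<in> I"
  by (simp add: zero_A residue_class_eq_iff mem_iff_lookup)

text \<open>Membership is tested monomial by monomial, so every term of an element of
  \<open>I\<close> lies in \<open>I\<close> again. Terms are homogeneous, hence the homogeneous
  elements of \<open>I\<close> generate it.\<close>

lemma homogeneous: "homogeneous_ideal I"
proof -
  define S where "S = {p \<in> I. \<exists>d. p \<in> forms d}"
  have "p \<in> Idl\<^bsub>mpoly_ring\<^esub> S" if p: "p \<in> I" for p
  proof -
    interpret J: ideal "Idl\<^bsub>mpoly_ring\<^esub> S" mpoly_ring
      by (rule genideal_ideal) simp
    have sum: "sum f M \<in> Idl\<^bsub>mpoly_ring\<^esub> S"
      if "finite M" "\<And>x. x \<in> M \<Longrightarrow> f x \<in> S" for f and M :: "('v \<Rightarrow>\<^sub>0 nat) set"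
      using that
    proof (induction M)
      case empty
      then show ?case using J.zero_closed by simp
    next
      case (insert x M)
      then show ?case
        using genideal_self[of S] J.a_closed[of "f x" "sum f M"] by auto
    qed
    have "Poly_Mapping.single m (Poly_Mapping.lookup p m) \<in> S" if "m \<in> Poly_Mapping.keys p" for m
      using that p by (auto simp: S_def mem_iff forms_def)
    then show ?thesis
      using sum[of "Poly_Mapping.keys p" "\<lambda>m. Poly_Mapping.single m (Poly_Mapping.lookup p m)"]
      by (simp flip: poly_mapping_eq_sum_single)
  qed
  moreover have "Idl\<^bsub>mpoly_ring\<^esub> S \<subseteq> I"
    by (rule genideal_minimal) (auto simp: S_def is_ideal)
  ultimately have "I = Idl\<^bsub>mpoly_ring\<^esub> S" by blast
  moreover have "S \<subseteq> (\<Union>d. forms d)" by (auto simp: S_def)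
  ultimately show ?thesis
    unfolding homogeneous_ideal_def using is_ideal by blast
qed

section \<open>Dimensions over the base field\<close>

text \<open>The base field is the image of a field under a ring homomorphism into \<open>A\<close>,
  and \<open>A\<close> is nonzero because the monomial 1 is standard.\<close>

lemma subfield_base_field: "subfield (base_field I) A"
proof -
  interpret k: field "ring_of_type_algebra :: 'k ring" by rule
  interpret h: ring_hom_ring "ring_of_type_algebra :: 'k ring" A "residue_class I \<circ> const"
    by (rule ring_hom_ringI2[OF k.ring_axioms A.ring_axioms], rule ring_hom_memI)
      (simp_all add: residue_class_simps const_add const_mult const_one)
  have "\<one>\<^bsub>A\<^esub> \<noteq> \<zero>\<^bsub>A\<^esub>"
    using zero_notin by (auto simp: residue_class_simps zero_A residue_class_eq_iff)
  from h.img_is_subfield(2)[OF k.carrier_is_subfield this]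
  show ?thesis
    by (simp add: base_field_def image_comp)
qed

text \<open>Standard monomials are linearly independent modulo \<open>I\<close>: adjoining
  \<open>m\<close> to \<open>M\<close> extends the span by one line, since every polynomial
  supported on \<open>M\<close> has coefficient 0 at \<open>m\<close> while the monomial itself has
  coefficient 1 there.\<close>

lemma dimension_monomials:
  assumes "finite M" "M \<inter> B = {}"
  shows "A.dimension (card M) (base_field I) (residue_class I ` {p. Poly_Mapping.keys p \<subseteq> M})"
  using assms
proof (induction M)
  case empty
  then show ?case by (simp add: zero_A[symmetric])
next
  case (insert m M)
  let ?E = "\<lambda>M. residue_class I ` {p. Poly_Mapping.keys p \<subseteq> M}"
  let ?v = "residue_class I (Poly_Mapping.single m 1)"
  have notin: "?v \<notin> ?E M"
  proof
    assume "?v \<in> ?E M"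
    then obtain p where "Poly_Mapping.keys p \<subseteq> M" "?v = residue_class I p" by blast
    moreover from this insert have "Poly_Mapping.lookup p m = 0" by (auto simp: in_keys_iff)
    ultimately show False using insert by (auto simp: residue_class_eq_iff dest!: spec[of _ m])
  qed
  have "A.line_extension (base_field I) ?v (?E M) = ?E (insert m M)"
  proof (intro equalityI subsetI)
    fix a assume "a \<in> A.line_extension (base_field I) ?v (?E M)"
    then obtain c p where p: "Poly_Mapping.keys p \<subseteq> M"
      and a: "a = residue_class I (const c * Poly_Mapping.single m 1 + p)"
      by (auto simp: A.line_extension_mem_iff base_field_def residue_class_simps)
    have "Poly_Mapping.keys (const c * Poly_Mapping.single m 1 + p) \<subseteq> insert m M"
      using p by (auto simp: in_keys_iff lookup_add lookup_single when_def split: if_splits)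
    with a show "a \<in> ?E (insert m M)" by blast
  next
    fix a assume "a \<in> ?E (insert m M)"
    then obtain p where p: "Poly_Mapping.keys p \<subseteq> insert m M" and a: "a = residue_class I p"
      by blast
    define c where "c = Poly_Mapping.lookup p m"
    define q where "q = p - const c * Poly_Mapping.single m 1"
    have "Poly_Mapping.keys q \<subseteq> M"
      using p by (auto simp: q_def c_def in_keys_iff lookup_minus lookup_single when_def split: if_splits)
    moreover have "a = residue_class I (const c) \<otimes>\<^bsub>A\<^esub> ?v \<oplus>\<^bsub>A\<^esub> residue_class I q"
      by (simp add: a q_def residue_class_simps)
    ultimately show "a \<in> A.line_extension (base_field I) ?v (?E M)"
      unfolding A.line_extension_mem_iff base_field_def by blast
  qed
  with A.Suc_dim[OF residue_class_carrier notin, of "card M" "base_field I"] insert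
  show ?case by simp
qed

text \<open>Deleting the terms in \<open>B\<close> does not change a residue class. This brings
  graded pieces and the whole carrier into the shape required by
  \<open>dimension_monomials\<close>.\<close>

lemma residue_class_image_eq:
  assumes "\<And>p. p \<in> S \<Longrightarrow> Poly_Mapping.keys p \<subseteq> B \<union> M"
    and "\<And>p. Poly_Mapping.keys p \<subseteq> M \<Longrightarrow> p \<in> S"
  shows "residue_class I ` S = residue_class I ` {p. Poly_Mapping.keys p \<subseteq> M}"
proof (intro equalityI subsetI)
  fix a assume "a \<in> residue_class I ` S"
  then obtain p where p: "p \<in> S" "a = residue_class I p" by blast
  \<comment> \<open>The normal form of \<open>p\<close>: its part supported on standard
    monomials.\<close>
  define q where "q = (\<Sum>m\<in>Poly_Mapping.keys p - B. Poly_Mapping.single m (Poly_Mapping.lookup p m))"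
  have q: "Poly_Mapping.lookup q m = (if m \<in> B then 0 else Poly_Mapping.lookup p m)" for m
    by (auto simp: q_def lookup_sum lookup_single when_def in_keys_iff)
  then have "Poly_Mapping.keys q \<subseteq> M"
    using assms(1)[OF p(1)] by (auto simp: in_keys_iff split: if_splits)
  moreover have "a = residue_class I q" by (simp add: p residue_class_eq_iff q)
  ultimately show "a \<in> residue_class I ` {p. Poly_Mapping.keys p \<subseteq> M}" by blast
qed (use assms(2) in auto)

lemma dim_graded_piece:
  assumes "finite {m. m \<notin> B \<and> monomial_degree m = i}"
  shows "dim_k I (graded_piece I i) = card {m. m \<notin> B \<and> monomial_degree m = i}"
proof -
  let ?M = "{m. m \<notin> B \<and> monomial_degree m = i}"
  have "graded_piece I i = residue_class I ` {p. Poly_Mapping.keys p \<subseteq> ?M}"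
    unfolding graded_piece_def by (rule residue_class_image_eq) (auto simp: forms_def)
  with dimension_monomials[OF assms] A.dimI[OF subfield_base_field] show ?thesis
    by (auto simp: dim_k_def over_def)
qed

lemma finite_dimension_carrier:
  assumes "finite (- B)"
  shows "A.finite_dimension (base_field I) (carrier A)"
proof -
  have "carrier A = residue_class I ` {p. Poly_Mapping.keys p \<subseteq> - B}"
    unfolding carrier_A by (rule residue_class_image_eq) auto
  with dimension_monomials[OF assms] A.finite_dimensionI show ?thesis by auto
qed

section \<open>Socles of monomial quotients\<close>

text \<open>The annihilator of a class is an ideal, so it contains the irrelevant ideal as soon as
  it contains the classes of the variables.\<close>

lemma socle_iff: "residue_class I p \<in> socle I \<longleftrightarrow> (\<forall>x. p * var x \<in> I)"
proof -
  let ?a = "residue_class I p" and ?V = "residue_class I ` range var"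
  have V: "?V \<subseteq> carrier A" by auto
  have "ideal {b \<in> carrier A. ?a \<otimes>\<^bsub>A\<^esub> b = \<zero>\<^bsub>A\<^esub>} A"
  proof (rule idealI[OF A.ring_axioms])
    show "subgroup {b \<in> carrier A. ?a \<otimes>\<^bsub>A\<^esub> b = \<zero>\<^bsub>A\<^esub>} (add_monoid A)"
    proof (rule A.add.subgroupI)
      show "{b \<in> carrier A. ?a \<otimes>\<^bsub>A\<^esub> b = \<zero>\<^bsub>A\<^esub>} \<noteq> {}"
        using A.r_null[OF residue_class_carrier] by blast
    qed (auto simp: A.r_distr A.r_minus simp flip: a_inv_def)
    have left: "?a \<otimes>\<^bsub>A\<^esub> (y \<otimes>\<^bsub>A\<^esub> x) = \<zero>\<^bsub>A\<^esub>"
      if "x \<in> carrier A" "y \<in> carrier A" "?a \<otimes>\<^bsub>A\<^esub> x = \<zero>\<^bsub>A\<^esub>" for x y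
      using that by (metis A.m_lcomm A.r_null residue_class_carrier)
    then show "y \<otimes>\<^bsub>A\<^esub> x \<in> {b \<in> carrier A. ?a \<otimes>\<^bsub>A\<^esub> b = \<zero>\<^bsub>A\<^esub>}"
      "x \<otimes>\<^bsub>A\<^esub> y \<in> {b \<in> carrier A. ?a \<otimes>\<^bsub>A\<^esub> b = \<zero>\<^bsub>A\<^esub>}"
      if "x \<in> {b \<in> carrier A. ?a \<otimes>\<^bsub>A\<^esub> b = \<zero>\<^bsub>A\<^esub>}" "y \<in> carrier A" for x y
      using that by (auto simp: A.m_comm[of x y])
  qed
  note ann = A.genideal_minimal[OF this, of ?V, folded irrelevant_ideal_def]
  have sub: "?V \<subseteq> irrelevant_ideal I" "irrelevant_ideal I \<subseteq> carrier A"
    unfolding irrelevant_ideal_def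
    by (rule A.genideal_self[OF V], rule A.genideal_minimal[OF A.oneideal V])
  have "?a \<in> socle I \<longleftrightarrow> irrelevant_ideal I \<subseteq> {b \<in> carrier A. ?a \<otimes>\<^bsub>A\<^esub> b = \<zero>\<^bsub>A\<^esub>}"
    unfolding socle_def using sub(2) residue_class_carrier[of p] by blast
  also have "\<dots> \<longleftrightarrow> ?V \<subseteq> {b \<in> carrier A. ?a \<otimes>\<^bsub>A\<^esub> b = \<zero>\<^bsub>A\<^esub>}"
    using ann sub(1) by blast
  also have "\<dots> \<longleftrightarrow> (\<forall>x. p * var x \<in> I)"
    by (simp add: image_subset_iff residue_class_simps residue_class_eq_zero_iff)
  finally show ?thesis .
qed

text \<open>The coefficient of \<open>p\<close> at \<open>m\<close> reappears in
  \<open>p * var x\<close> at the monomial \<open>m\<close> times \<open>x\<close>. If that monomial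
  is standard and \<open>p * var x\<close> lies in \<open>I\<close>, the coefficient must
  vanish.\<close>

lemma socle_piece_eq_zero:
  assumes "\<And>m. m \<notin> B \<Longrightarrow> monomial_degree m = i \<Longrightarrow> \<exists>x. m + Poly_Mapping.single x 1 \<notin> B"
  shows "socle_piece I i = {\<zero>\<^bsub>A\<^esub>}"
proof (intro equalityI subsetI)
  fix a assume "a \<in> socle_piece I i"
  then obtain p where p: "p \<in> forms i" "a = residue_class I p" "\<forall>x. p * var x \<in> I"
    by (auto simp: socle_piece_def graded_piece_def socle_iff)
  have "Poly_Mapping.lookup p m = 0" if "m \<notin> B" for m
  proof (cases "monomial_degree m = i")
    case True
    with assms that obtain x where "m + Poly_Mapping.single x 1 \<notin> B" by blast
    with p(3) lookup_times_single_add[of p "Poly_Mapping.single x 1" 1 m] show ?thesis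
      by (simp add: mem_iff_lookup var_def)
  qed (use p(1) in \<open>auto simp: forms_lookup\<close>)
  then show "a \<in> {\<zero>\<^bsub>A\<^esub>}" by (simp add: p residue_class_eq_zero_iff mem_iff_lookup)
next
  fix a assume "a \<in> {\<zero>\<^bsub>A\<^esub>}"
  then show "a \<in> socle_piece I i"
    by (auto simp: socle_piece_def graded_piece_def zero_A socle_iff mem_iff_lookup forms_lookup)
qed

text \<open>Multiplying by a variable lands in degree \<open>Suc i\<close>, where the quotient is
  zero.\<close>

lemma socle_piece_eq_graded_piece:
  assumes "\<And>m. monomial_degree m = Suc i \<Longrightarrow> m \<in> B"
  shows "socle_piece I i = graded_piece I i"
proof -
  have "p * var x \<in> I" if "p \<in> forms i" for p and x
    using that keys_mult[of p "var x"] assms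
    by (fastforce simp: mem_iff forms_def var_def)
  then show ?thesis by (auto simp: socle_piece_def graded_piece_def socle_iff)
qed

end

section \<open>The algebra $k[x,y,z]/(x^3,y^3,z^3,xyz)$\<close>

text \<open>The case split guards against truncated subtraction: if \<open>x\<close> does not divide
  \<open>m\<close>, then \<open>m - Poly_Mapping.single x 1\<close> is \<open>m\<close> itself and
  would contribute a false coefficient.\<close>

lemma lookup_times_var:
  fixes p :: "('v, 'k::field) mpoly"
  shows "Poly_Mapping.lookup (p * var x) m =
    (if Poly_Mapping.lookup m x = 0 then 0
     else Poly_Mapping.lookup p (m - Poly_Mapping.single x 1))"
proof (cases "Poly_Mapping.lookup m x = 0")
  case True
  have "m \<noteq> l + Poly_Mapping.single x 1" for l
    using True by (auto simp: lookup_add)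
  with True show ?thesis by (simp add: var_def lookup_times_single_eq_0)
next
  case False
  then have "m = m - Poly_Mapping.single x 1 + Poly_Mapping.single x 1"
    by (intro poly_mapping_eqI) (auto simp: lookup_add lookup_minus lookup_single when_def)
  with False lookup_times_single_add[of p "Poly_Mapping.single x 1" 1 "m - Poly_Mapping.single x 1"]
  show ?thesis by (simp add: var_def)
qed

section \<open>Monomials and linear forms in three variables\<close>

lemma UNIV_3_eq: "(UNIV :: 3 set) = {0, 1, 2}"
  by (rule card_seteq[symmetric]) auto

text \<open>The exponent vector of \<open>x^i y^j z^k\<close>, where the variables x, y, z are
  indexed by the elements 0, 1, 2 of the numeral type \<open>3\<close>.\<close>

definition mon :: "nat \<Rightarrow> nat \<Rightarrow> nat \<Rightarrow> (3 \<Rightarrow>\<^sub>0 nat)" where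
  "mon i j k = Poly_Mapping.single 0 i + Poly_Mapping.single 1 j + Poly_Mapping.single 2 k"

lemma lookup_mon [simp]:
  "Poly_Mapping.lookup (mon i j k) 0 = i"
  "Poly_Mapping.lookup (mon i j k) 1 = j"
  "Poly_Mapping.lookup (mon i j k) 2 = k"
  by (simp_all add: mon_def lookup_add lookup_single)

lemma all_3_iff: "(\<forall>x::3. P x) \<longleftrightarrow> P 0 \<and> P 1 \<and> P 2"
  using UNIV_3_eq by (metis UNIV_I empty_iff insert_iff)

lemma ex_3_iff: "(\<exists>x::3. P x) \<longleftrightarrow> P 0 \<or> P 1 \<or> P 2"
  using all_3_iff[of "\<lambda>x. \<not> P x"] by blast

lemma monomial_eq_iff:
  fixes m :: "3 \<Rightarrow>\<^sub>0 nat"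
  shows "m = n \<longleftrightarrow> Poly_Mapping.lookup m 0 = Poly_Mapping.lookup n 0 \<and>
    Poly_Mapping.lookup m 1 = Poly_Mapping.lookup n 1 \<and>
    Poly_Mapping.lookup m 2 = Poly_Mapping.lookup n 2"
  by (simp add: poly_mapping_eq_iff fun_eq_iff all_3_iff)

lemma mon_eq_iff [simp]: "mon i j k = mon i' j' k' \<longleftrightarrow> i = i' \<and> j = j' \<and> k = k'"
  by (simp add: monomial_eq_iff)

lemma mon_cases: obtains i j k where "m = mon i j k"
  using that[of "Poly_Mapping.lookup m 0" "Poly_Mapping.lookup m 1" "Poly_Mapping.lookup m 2"]
  by (simp add: monomial_eq_iff)

lemma all_mon_iff: "(\<forall>m. P m) \<longleftrightarrow> (\<forall>i j k. P (mon i j k))"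
  by (metis mon_cases)

lemma monomial_degree_mon [simp]: "monomial_degree (mon i j k) = i + j + k"
  by (simp add: mon_def)

lemma mon_add_single:
  "mon i j k + Poly_Mapping.single 0 n = mon (i + n) j k"
  "mon i j k + Poly_Mapping.single 1 n = mon i (j + n) k"
  "mon i j k + Poly_Mapping.single 2 n = mon i j (k + n)"
  by (simp_all add: monomial_eq_iff lookup_add lookup_single)

lemma mon_minus_single:
  "mon i j k - Poly_Mapping.single 0 n = mon (i - n) j k"
  "mon i j k - Poly_Mapping.single 1 n = mon i (j - n) k"
  "mon i j k - Poly_Mapping.single 2 n = mon i j (k - n)"
  by (simp_all add: monomial_eq_iff lookup_minus lookup_single)

text \<open>Comparing coefficients gives \<open>L = a x + b y + c z\<close>. Only the resulting rule
  for multiplication by \<open>L\<close> is exported, because the later arguments need nothing but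
  the coefficients of products; the tests for 0 again guard the truncated subtraction.\<close>

lemma linear_form_coeffs:
  fixes L :: "(3, 'k::field) mpoly"
  assumes "L \<in> forms 1"
  obtains a b c where "\<And>p i j k. Poly_Mapping.lookup (L * p) (mon i j k) =
      (if i = 0 then 0 else a * Poly_Mapping.lookup p (mon (i - 1) j k)) +
      (if j = 0 then 0 else b * Poly_Mapping.lookup p (mon i (j - 1) k)) +
      (if k = 0 then 0 else c * Poly_Mapping.lookup p (mon i j (k - 1)))"
proof -
  let ?c = "\<lambda>m. const (Poly_Mapping.lookup L m)"
  have "Poly_Mapping.lookup L (mon i j k) =
      Poly_Mapping.lookup (?c (mon 1 0 0) * var 0 + ?c (mon 0 1 0) * var 1 + ?c (mon 0 0 1) * var 2)
        (mon i j k)" for i j k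
  proof (cases "i + j + k = 1")
    case True
    then consider "i = 1" "j = 0" "k = 0" | "i = 0" "j = 1" "k = 0" | "i = 0" "j = 0" "k = 1"
      by linarith
    then show ?thesis
      by cases (simp_all add: lookup_add var_def lookup_single when_def monomial_eq_iff)
  next
    case False
    then have "Poly_Mapping.lookup L (mon i j k) = 0"
      using assms by (simp add: forms_lookup)
    with False show ?thesis
      by (auto simp: lookup_add var_def lookup_single when_def monomial_eq_iff)
  qed
  then have L: "L = ?c (mon 1 0 0) * var 0 + ?c (mon 0 1 0) * var 1 + ?c (mon 0 0 1) * var 2"
    by (intro poly_mapping_eqI) (metis mon_cases)
  have L_times: "L * p = ?c (mon 1 0 0) * (p * var 0) + ?c (mon 0 1 0) * (p * var 1)
      + ?c (mon 0 0 1) * (p * var 2)" for p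
    by (subst L) (simp add: algebra_simps)
  show ?thesis
    by (rule that[of "Poly_Mapping.lookup L (mon 1 0 0)" "Poly_Mapping.lookup L (mon 0 1 0)"
          "Poly_Mapping.lookup L (mon 0 0 1)"], subst L_times) (simp add: lookup_add lookup_times_var mon_minus_single)
qed

section \<open>The ideal, its standard monomials and its socle\<close>

definition cubes_and_xyz :: "(3 \<Rightarrow>\<^sub>0 nat) set" where
  "cubes_and_xyz = {m. (\<exists>x. 3 \<le> Poly_Mapping.lookup m x) \<or> (\<forall>x. 1 \<le> Poly_Mapping.lookup m x)}"

text \<open>This is the ideal generated by \<open>x^3\<close>, \<open>y^3\<close>,
  \<open>z^3\<close> and \<open>xyz\<close>, given by supports: a polynomial lies in a monomial
  ideal iff each of its monomials does.\<close>

definition cubes_and_xyz_ideal :: "(3, 'k::field) mpoly set" where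
  "cubes_and_xyz_ideal = {p. Poly_Mapping.keys p \<subseteq> cubes_and_xyz}"

lemma monomial_ideal_example:
  "monomial_ideal cubes_and_xyz (cubes_and_xyz_ideal :: (3, 'k::field) mpoly set)"
proof
  show "n + m \<in> cubes_and_xyz" if "m \<in> cubes_and_xyz" for m n
    using that by (auto simp: cubes_and_xyz_def lookup_add intro: trans_le_add2)
qed (simp_all add: cubes_and_xyz_ideal_def, simp add: cubes_and_xyz_def)

lemmas example_dim_graded_piece = monomial_ideal.dim_graded_piece[OF monomial_ideal_example]
  and example_finite_dimension_carrier = monomial_ideal.finite_dimension_carrier[OF monomial_ideal_example]
  and example_homogeneous = monomial_ideal.homogeneous[OF monomial_ideal_example]
  and example_mem_iff = monomial_ideal.mem_iff[OF monomial_ideal_example]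
  and example_mem_iff_lookup = monomial_ideal.mem_iff_lookup[OF monomial_ideal_example]
  and example_residue_class_eq_iff = monomial_ideal.residue_class_eq_iff[OF monomial_ideal_example]
  and example_residue_class_simps = monomial_ideal.residue_class_simps[OF monomial_ideal_example]
  and example_socle_piece_eq_graded_piece = monomial_ideal.socle_piece_eq_graded_piece[OF monomial_ideal_example]
  and example_socle_piece_eq_zero = monomial_ideal.socle_piece_eq_zero[OF monomial_ideal_example]

lemma mon_mem_iff [simp]:
  "mon i j k \<in> cubes_and_xyz \<longleftrightarrow> 3 \<le> i \<or> 3 \<le> j \<or> 3 \<le> k \<or> 1 \<le> i \<and> 1 \<le> j \<and> 1 \<le> k"
  by (simp add: cubes_and_xyz_def ex_3_iff all_3_iff)

lemma finite_standard_monomials: "finite (- cubes_and_xyz)"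
proof (rule finite_subset)
  show "- cubes_and_xyz \<subseteq> (\<lambda>(i, j, k). mon i j k) ` ({..2} \<times> {..2} \<times> {..2})"
  proof
    fix m assume m: "m \<in> - cubes_and_xyz"
    obtain i j k where "m = mon i j k" by (rule mon_cases)
    with m show "m \<in> (\<lambda>(i, j, k). mon i j k) ` ({..2} \<times> {..2} \<times> {..2})"
      by (intro image_eqI[of _ _ "(i, j, k)"]) auto
  qed
qed simp

lemma h_vector_eq_card:
  "h_vector (cubes_and_xyz_ideal :: (3, 'k::field) mpoly set) i =
     card {m. m \<notin> cubes_and_xyz \<and> monomial_degree m = i}"
  unfolding h_vector_def
  by (rule example_dim_graded_piece) (rule finite_subset[OF _ finite_standard_monomials], auto)

lemma standard_monomials_1:
  "{m. m \<notin> cubes_and_xyz \<and> monomial_degree m = 1} = {mon 1 0 0, mon 0 1 0, mon 0 0 1}"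
  unfolding set_eq_iff all_mon_iff by auto

lemma standard_monomials_4:
  "{m. m \<notin> cubes_and_xyz \<and> monomial_degree m = 4} = {mon 2 2 0, mon 2 0 2, mon 0 2 2}"
  unfolding set_eq_iff all_mon_iff by auto

text \<open>A standard monomial omits a variable and has its other two exponents at most 2, so its
  degree is at most 4.\<close>

lemma degree_ge_5_mem: "5 \<le> monomial_degree m \<Longrightarrow> m \<in> cubes_and_xyz"
  by (rule mon_cases[of m]) auto

lemma socle_degree_eq: "socle_degree (cubes_and_xyz_ideal :: (3, 'k::field) mpoly set) = 4"
  unfolding socle_degree_def
proof (rule Greatest_equality)
  show "0 < h_vector (cubes_and_xyz_ideal :: (3, 'k) mpoly set) 4"
    by (simp add: h_vector_eq_card standard_monomials_4)
  show "i \<le> 4" if "0 < h_vector (cubes_and_xyz_ideal :: (3, 'k) mpoly set) i" for i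
  proof (rule ccontr)
    assume "\<not> i \<le> 4"
    then have "{m. m \<notin> cubes_and_xyz \<and> monomial_degree m = i} = {}"
      using degree_ge_5_mem by force
    with that show False by (simp add: h_vector_eq_card)
  qed
qed

lemma level_example: "level_of_type (cubes_and_xyz_ideal :: (3, 'k::field) mpoly set) 3"
proof -
  let ?I = "cubes_and_xyz_ideal :: (3, 'k) mpoly set"
  have "socle_piece ?I i = {\<zero>\<^bsub>quotient_alg ?I\<^esub>}" if "i < 4" for i
  proof (rule example_socle_piece_eq_zero)
    \<comment> \<open>Some variable is missing from \<open>m\<close>. Below degree 4 the other two
      exponents cannot both be 2, so one of them can be raised without leaving the standard
      monomials.\<close>
    fix m assume "m \<notin> cubes_and_xyz" "monomial_degree m = i"
    with that show "\<exists>x. m + Poly_Mapping.single x 1 \<notin> cubes_and_xyz"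
      by (cases m rule: mon_cases) (simp add: ex_3_iff mon_add_single, linarith)
  qed
  moreover have "socle_piece ?I 4 = graded_piece ?I 4"
    by (rule example_socle_piece_eq_graded_piece) (simp add: degree_ge_5_mem)
  moreover have "dim_k ?I (graded_piece ?I 4) = 3"
    using h_vector_eq_card[where ?'k = 'k, of 4]
    by (simp add: h_vector_def standard_monomials_4)
  ultimately show ?thesis by (simp add: level_of_type_def socle_degree_eq)
qed

lemma standard_graded_artinian_example:
  "standard_graded_artinian (cubes_and_xyz_ideal :: (3, 'k::field) mpoly set)"
  unfolding standard_graded_artinian_def
proof (intro conjI allI impI ballI)
  fix d and p :: "(3, 'k) mpoly"
  assume d: "d \<le> 1" and p: "p \<in> cubes_and_xyz_ideal \<inter> forms d"
  \<comment> \<open>All four generators are cubic.\<close>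
  have "3 \<le> monomial_degree m" if "m \<in> cubes_and_xyz" for m
    using that by (cases m rule: mon_cases) auto
  with d p have "Poly_Mapping.keys p = {}"
    by (fastforce simp: example_mem_iff forms_def)
  then show "p = 0" by simp
qed (rule example_homogeneous, rule example_finite_dimension_carrier[OF finite_standard_monomials])

section \<open>Failure of maximal rank from degree 2 to degree 3\<close>

text \<open>
  The factorisation
  $(ax+by+cz)(a^2x^2+b^2y^2+c^2z^2-ab\,xy-ac\,xz-bc\,yz) = a^3x^3+b^3y^3+c^3z^3-3abc\,xyz$
  exhibits a quadric annihilated by the linear form.
\<close>

lemma mult_linear_form_not_inj:
  fixes L :: "(3, 'k::field) mpoly"
  assumes L: "L \<in> forms 1"
  shows "\<exists>q\<in>forms 2. q \<notin> cubes_and_xyz_ideal \<and> L * q \<in> cubes_and_xyz_ideal"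
proof -
  obtain a b c where L_mult:
    "\<And>p i j k. Poly_Mapping.lookup (L * p) (mon i j k) =
      (if i = 0 then 0 else a * Poly_Mapping.lookup p (mon (i - 1) j k)) +
      (if j = 0 then 0 else b * Poly_Mapping.lookup p (mon i (j - 1) k)) +
      (if k = 0 then 0 else c * Poly_Mapping.lookup p (mon i j (k - 1)))"
    using linear_form_coeffs[OF L] by blast
  show ?thesis
  \<comment> \<open>For \<open>L = 0\<close> the quadric of the factorisation is itself zero. In
    that case any quadric outside the ideal will do, for instance \<open>x^2\<close>.\<close>
  proof (cases "a = 0 \<and> b = 0 \<and> c = 0")
    case True
    have "Poly_Mapping.single (mon 2 0 0) 1 \<in> (forms 2 :: (3, 'k) mpoly set)"
      "Poly_Mapping.single (mon 2 0 0) 1 \<notin> (cubes_and_xyz_ideal :: (3, 'k) mpoly set)"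
      by (simp_all add: forms_def example_mem_iff)
    moreover have "L * q \<in> cubes_and_xyz_ideal" for q
      using True by (simp add: example_mem_iff_lookup all_mon_iff L_mult)
    ultimately show ?thesis by blast
  next
    case False
    define q where "q = Poly_Mapping.single (mon 2 0 0) (a\<^sup>2) + Poly_Mapping.single (mon 0 2 0) (b\<^sup>2)
      + Poly_Mapping.single (mon 0 0 2) (c\<^sup>2) - Poly_Mapping.single (mon 1 1 0) (a * b)
      - Poly_Mapping.single (mon 1 0 1) (a * c) - Poly_Mapping.single (mon 0 1 1) (b * c)"
    have lookup_q: "Poly_Mapping.lookup q (mon i j k) =
       (a\<^sup>2 when i = 2 \<and> j = 0 \<and> k = 0) + (b\<^sup>2 when i = 0 \<and> j = 2 \<and> k = 0)
       + (c\<^sup>2 when i = 0 \<and> j = 0 \<and> k = 2) - (a * b when i = 1 \<and> j = 1 \<and> k = 0)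
       - (a * c when i = 1 \<and> j = 0 \<and> k = 1) - (b * c when i = 0 \<and> j = 1 \<and> k = 1)" for i j k
      by (auto simp: q_def lookup_add lookup_minus lookup_single when_def)
    have q_forms: "q \<in> forms 2"
      by (auto simp: forms_lookup all_mon_iff lookup_q when_def)
    have "q \<notin> cubes_and_xyz_ideal"
    proof
      assume "q \<in> cubes_and_xyz_ideal"
      then have "Poly_Mapping.lookup q (mon i j k) = 0" if "mon i j k \<notin> cubes_and_xyz" for i j k
        using that by (simp add: example_mem_iff_lookup)
      \<comment> \<open>The squares of the variables are standard, and their coefficients
        \<open>a^2\<close>, \<open>b^2\<close>, \<open>c^2\<close> do not all vanish.\<close>
      from this[of 2 0 0] this[of 0 2 0] this[of 0 0 2] False show False
        by (simp add: lookup_q)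
    qed
    moreover have "L * q \<in> cubes_and_xyz_ideal"
      unfolding example_mem_iff_lookup all_mon_iff
    proof (intro allI impI)
      fix i j k assume std: "mon i j k \<notin> cubes_and_xyz"
      show "Poly_Mapping.lookup (L * q) (mon i j k) = 0"
      proof (cases "i + j + k = 3")
        case True
        moreover have bounds: "i < 3" "j < 3" "k < 3" "i = 0 \<or> j = 0 \<or> k = 0"
          using std unfolding mon_mem_iff by linarith+
        moreover have "i = 0 \<or> i = 1 \<or> i = 2" "j = 0 \<or> j = 1 \<or> j = 2"
          using bounds by linarith+
        \<comment> \<open>These are the six standard cubics. At each of them two contributions
          cancel; at \<open>x^2 y\<close>, for example, they are \<open>a * (- a b)\<close> and
          \<open>b * a^2\<close>.\<close>
        ultimately consider "i = 2" "j = 1" "k = 0" | "i = 2" "j = 0" "k = 1"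
          | "i = 1" "j = 2" "k = 0" | "i = 0" "j = 2" "k = 1"
          | "i = 1" "j = 0" "k = 2" | "i = 0" "j = 1" "k = 2"
          by (elim disjE) simp_all
        then show ?thesis
          by cases (simp_all add: L_mult lookup_q power2_eq_square)
      next
        case False
        moreover have "Poly_Mapping.lookup q (mon i j k) = 0" if "i + j + k \<noteq> 2" for i j k
          using q_forms that by (simp add: forms_lookup)
        ultimately show ?thesis by (auto simp: L_mult)
      qed
    qed
    ultimately show ?thesis using q_forms by blast
  qed
qed

text \<open>Modulo the ideal, each of the six quadratic monomials times \<open>L\<close> involves at
  most two standard cubics, and these incidences arrange the six standard cubics in a cycle. Weights
  of alternating sign around the cycle cancel in pairs, which yields a functional vanishing on all
  multiples of \<open>L\<close>. If every standard cubic were such a multiple, all weights would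
  have to be zero.\<close>

lemma mult_linear_form_not_surj:
  fixes L :: "(3, 'k::field) mpoly"
  assumes L: "L \<in> forms 1"
  shows "\<exists>m. m \<notin> cubes_and_xyz \<and> monomial_degree m = 3 \<and>
    (\<forall>q. residue_class cubes_and_xyz_ideal (L * q) \<noteq>
         residue_class cubes_and_xyz_ideal (Poly_Mapping.single m 1))"
proof (rule ccontr)
  assume contr: "\<not> ?thesis"
  obtain a b c where L_mult:
    "\<And>p i j k. Poly_Mapping.lookup (L * p) (mon i j k) =
      (if i = 0 then 0 else a * Poly_Mapping.lookup p (mon (i - 1) j k)) +
      (if j = 0 then 0 else b * Poly_Mapping.lookup p (mon i (j - 1) k)) +
      (if k = 0 then 0 else c * Poly_Mapping.lookup p (mon i j (k - 1)))"
    using linear_form_coeffs[OF L] by blast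
  have hit: "\<exists>q. \<forall>m. m \<notin> cubes_and_xyz \<longrightarrow>
      Poly_Mapping.lookup (L * q) m = (if m = mon i j k then 1 else 0)"
    if "mon i j k \<notin> cubes_and_xyz" "i + j + k = 3" for i j k
  proof -
    have deg: "monomial_degree (mon i j k) = 3" using that(2) by simp
    have "\<exists>q. residue_class cubes_and_xyz_ideal (L * q)
        = residue_class cubes_and_xyz_ideal (Poly_Mapping.single (mon i j k) 1)"
      using contr that(1) deg by blast
    then show ?thesis
      by (simp add: example_residue_class_eq_iff lookup_single when_def eq_commute[of "mon i j k"])
  qed
  text \<open>A linear functional on the cubic part whose kernel contains every multiple of the linear form;
    it vanishes only if two of $a$, $b$, $c$ do.\<close>
  have relation: "b * c\<^sup>2 * Poly_Mapping.lookup (L * q) (mon 2 1 0)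
      - a * c\<^sup>2 * Poly_Mapping.lookup (L * q) (mon 1 2 0)
      + a\<^sup>2 * c * Poly_Mapping.lookup (L * q) (mon 0 2 1)
      - a\<^sup>2 * b * Poly_Mapping.lookup (L * q) (mon 0 1 2)
      + a * b\<^sup>2 * Poly_Mapping.lookup (L * q) (mon 1 0 2)
      - b\<^sup>2 * c * Poly_Mapping.lookup (L * q) (mon 2 0 1) = 0" for q
    by (simp add: L_mult algebra_simps power2_eq_square)
  \<comment> \<open>One cubic for each pair of variables: \<open>x^2 y\<close>, \<open>y^2 z\<close>
    and \<open>x z^2\<close>. Their weights \<open>b c^2\<close>, \<open>a^2 c\<close> and
    \<open>a b^2\<close> can vanish together only if at least two of \<open>a\<close>,
    \<open>b\<close>, \<open>c\<close> are zero.\<close>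
  obtain q1 where q1: "\<And>m. m \<notin> cubes_and_xyz \<Longrightarrow>
      Poly_Mapping.lookup (L * q1) m = (if m = mon 2 1 0 then 1 else 0)"
    using hit[of 2 1 0] by auto
  obtain q2 where q2: "\<And>m. m \<notin> cubes_and_xyz \<Longrightarrow>
      Poly_Mapping.lookup (L * q2) m = (if m = mon 0 2 1 then 1 else 0)"
    using hit[of 0 2 1] by auto
  obtain q3 where q3: "\<And>m. m \<notin> cubes_and_xyz \<Longrightarrow>
      Poly_Mapping.lookup (L * q3) m = (if m = mon 1 0 2 then 1 else 0)"
    using hit[of 1 0 2] by auto
  have "b * c\<^sup>2 = 0" using relation[of q1] by (simp add: q1)
  moreover have "a\<^sup>2 * c = 0" using relation[of q2] by (simp add: q2)
  moreover have "a * b\<^sup>2 = 0" using relation[of q3] by (simp add: q3)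
  \<comment> \<open>The coefficient of \<open>L * q1\<close> at \<open>x^2 y\<close> is a
    combination of \<open>a\<close> and \<open>b\<close> alone; being 1, it excludes
    \<open>a = b = 0\<close>. The other two pairs are treated alike, so at most one of
    \<open>a\<close>, \<open>b\<close>, \<open>c\<close> is zero.\<close>
  moreover have "a \<noteq> 0 \<or> b \<noteq> 0" using q1[of "mon 2 1 0"] by (auto simp: L_mult)
  moreover have "b \<noteq> 0 \<or> c \<noteq> 0" using q2[of "mon 0 2 1"] by (auto simp: L_mult)
  moreover have "a \<noteq> 0 \<or> c \<noteq> 0" using q3[of "mon 1 0 2"] by (auto simp: L_mult)
  ultimately show False by auto
qed

text \<open>Every linear form already fails at the map from degree 2 to degree 3, which the
  definition covers because the socle degree is 4.\<close>

lemma not_weak_lefschetz_example: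
  "\<not> weak_lefschetz (cubes_and_xyz_ideal :: (3, 'k::field) mpoly set)"
proof
  let ?I = "cubes_and_xyz_ideal :: (3, 'k) mpoly set"
  let ?\<mu> = "\<lambda>L a. residue_class ?I L \<otimes>\<^bsub>quotient_alg ?I\<^esub> a"
  assume "weak_lefschetz ?I"
  then obtain L where L: "L \<in> forms 1"
    and "inj_on (?\<mu> L) (graded_piece ?I 2) \<or>
      ?\<mu> L ` graded_piece ?I 2 = graded_piece ?I (Suc 2)"
    unfolding weak_lefschetz_def socle_degree_eq Let_def
    by (metis numeral_less_iff semiring_norm(76,78,80,81))
  then show False
  proof (elim disjE)
    assume inj: "inj_on (?\<mu> L) (graded_piece ?I 2)"
    obtain q where q: "q \<in> forms 2" "q \<notin> ?I" "L * q \<in> ?I"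
      using mult_linear_form_not_inj[OF L] by blast
    \<comment> \<open>The class of the annihilated quadric and the zero class are distinct elements
      of degree 2 with the same image.\<close>
    have "0 \<in> (forms 2 :: (3, 'k) mpoly set)" by (simp add: forms_def)
    with q have "residue_class ?I q \<in> graded_piece ?I 2" "residue_class ?I 0 \<in> graded_piece ?I 2"
      by (auto simp: graded_piece_def)
    moreover have "?\<mu> L (residue_class ?I q) = ?\<mu> L (residue_class ?I 0)"
      using q(3) by (simp add: example_residue_class_simps example_residue_class_eq_iff example_mem_iff_lookup)
    ultimately have "residue_class ?I q = residue_class ?I 0" using inj by (simp add: inj_on_def)
    with q(2) show False by (auto simp: example_residue_class_eq_iff example_mem_iff_lookup)
  next
    assume surj: "?\<mu> L ` graded_piece ?I 2 = graded_piece ?I (Suc 2)"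
    obtain m where m: "monomial_degree m = 3"
      "\<And>q. residue_class ?I (L * q) \<noteq> residue_class ?I (Poly_Mapping.single m 1)"
      using mult_linear_form_not_surj[OF L] by blast
    have "residue_class ?I (Poly_Mapping.single m 1) \<in> graded_piece ?I (Suc 2)"
      using m(1) by (auto simp: graded_piece_def forms_def)
    then obtain q where "residue_class ?I (Poly_Mapping.single m 1) = ?\<mu> L (residue_class ?I q)"
      unfolding surj[symmetric] by (auto simp: graded_piece_def)
    with m(2)[of q] show False by (simp add: example_residue_class_simps)
  qed
qed

theorem proposition8:
  shows "\<exists>I :: (3, 'k::field_char_0) mpoly set.
           standard_graded_artinian I \<and> codimension I = 3 \<and>
           level_of_type I 3 \<and> \<not> weak_lefschetz I"
proof (intro exI conjI)
  show "codimension (cubes_and_xyz_ideal :: (3, 'k) mpoly set) = 3"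
    unfolding codimension_def h_vector_eq_card standard_monomials_1 by simp
qed (rule standard_graded_artinian_example level_example not_weak_lefschetz_example)+

end
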